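(* Let $G$ be a finite simple undirected graph that is claw-free and AT-free, with chromatic number $\chi(G)$. Then $\mathrm{cub}(G) \le \chi(G)$.
   Context: An asteroidal triple is an independent set of three vertices such that between each pair there is a path avoiding the neighbourhood of the third; $G$ is AT-free if it has none. $G$ is claw-free if it has no induced subgraph isomorphic to $K_{1,3}$. The cubicity $\mathrm{cub}(G)$ is the minimum integer $k$ such that $G$ is the intersection graph of a family of axis-parallel unit cubes in $\mathbb{R}^k$ (products $[a_1,a_1+1]\times\cdots\times[a_k,a_k+1]$), equivalently the minimum $k$ such that $G=I_1\cap\cdots\cap I_k$ for unit interval graphs $I_j$ on vertex set $V(G)$. *)

theory Defs
  imports
    Complex_Main
    "HOL-Library.FuncSet"
    "Graph_Theory.Graph_Theory"
begin

definition neighbourhood :: "('a, 'b) pre_digraph \<Rightarrow> 'a \<Rightarrow> 'a set" where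
  "neighbourhood G v = {u. v \<rightarrow>\<^bsub>G\<^esub> u}"

definition independent_set :: "('a, 'b) pre_digraph \<Rightarrow> 'a set \<Rightarrow> bool" where
  "independent_set G S \<longleftrightarrow> S \<subseteq> verts G \<and> (\<forall>u\<in>S. \<forall>v\<in>S. \<not> u \<rightarrow>\<^bsub>G\<^esub> v)"

definition path_avoiding :: "('a, 'b) pre_digraph \<Rightarrow> 'a \<Rightarrow> 'a \<Rightarrow> 'a set \<Rightarrow> bool" where
  "path_avoiding G u v S \<longleftrightarrow> (\<exists>p. vpath p G \<and> hd p = u \<and> last p = v \<and> set p \<inter> S = {})"

text \<open>
  The open neighbourhood of the third vertex is avoided. As the triple is independent, a path
  between two of its vertices that passes through the third one meets this neighbourhood, so the
  closed neighbourhood is then avoided as well.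
\<close>

definition asteroidal_triple :: "('a, 'b) pre_digraph \<Rightarrow> 'a \<Rightarrow> 'a \<Rightarrow> 'a \<Rightarrow> bool" where
  "asteroidal_triple G a b c \<longleftrightarrow>
     distinct [a, b, c] \<and> independent_set G {a, b, c} \<and>
     path_avoiding G a b (neighbourhood G c) \<and>
     path_avoiding G b c (neighbourhood G a) \<and>
     path_avoiding G a c (neighbourhood G b)"

definition AT_free :: "('a, 'b) pre_digraph \<Rightarrow> bool" where
  "AT_free G \<longleftrightarrow> \<not> (\<exists>a b c. asteroidal_triple G a b c)"

definition claw_free :: "('a, 'b) pre_digraph \<Rightarrow> bool" where
  "claw_free G \<longleftrightarrow> \<not> (\<exists>H. induced_subgraph H G \<and> K\<^bsub>1,3\<^esub> H)"

definition proper_colouring :: "('a, 'b) pre_digraph \<Rightarrow> nat \<Rightarrow> ('a \<Rightarrow> nat) \<Rightarrow> bool" where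
  "proper_colouring G k c \<longleftrightarrow>
     c ` verts G \<subseteq> {..<k} \<and> (\<forall>u\<in>verts G. \<forall>v\<in>verts G. u \<rightarrow>\<^bsub>G\<^esub> v \<longrightarrow> c u \<noteq> c v)"

definition chromatic_number :: "('a, 'b) pre_digraph \<Rightarrow> nat" where
  "chromatic_number G = (LEAST k. \<exists>c. proper_colouring G k c)"

text \<open>
  Points of \<open>\<real>\<^sup>k\<close> are the extensional functions from \<open>{..<k}\<close> to the reals. For \<open>k = 0\<close> there is
  exactly one point, so precisely the complete graphs have cubicity 0.
\<close>

definition unit_cube :: "nat \<Rightarrow> (nat \<Rightarrow> real) \<Rightarrow> (nat \<Rightarrow> real) set" where
  "unit_cube k a = (\<Pi>\<^sub>E i\<in>{..<k}. {a i .. a i + 1})"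

definition cube_representation ::
    "('a, 'b) pre_digraph \<Rightarrow> nat \<Rightarrow> ('a \<Rightarrow> nat \<Rightarrow> real) \<Rightarrow> bool" where
  "cube_representation G k f \<longleftrightarrow>
     (\<forall>u\<in>verts G. \<forall>v\<in>verts G. u \<noteq> v \<longrightarrow>
        (u \<rightarrow>\<^bsub>G\<^esub> v \<longleftrightarrow> unit_cube k (f u) \<inter> unit_cube k (f v) \<noteq> {}))"

definition cubicity :: "('a, 'b) pre_digraph \<Rightarrow> nat" where
  "cubicity G = (LEAST k. \<exists>f. cube_representation G k f)"

text \<open>Both minima are taken over nonempty sets when \<open>G\<close> is a finite simple graph.\<close>

lemma unit_cube_Int_nonempty_iff:
  "unit_cube k a \<inter> unit_cube k b \<noteq> {} \<longleftrightarrow> (\<forall>i<k. \<bar>a i - b i\<bar> \<le> 1)"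
proof -
  have "unit_cube k a \<inter> unit_cube k b = (\<Pi>\<^sub>E i\<in>{..<k}. {a i .. a i + 1} \<inter> {b i .. b i + 1})"
    unfolding unit_cube_def by (rule PiE_Int)
  moreover have "{a i .. a i + 1} \<inter> {b i .. b i + 1} \<noteq> {} \<longleftrightarrow> \<bar>a i - b i\<bar> \<le> 1" for i
    by (auto simp: Int_atLeastAtMost)
  ultimately show ?thesis
    by (simp add: PiE_eq_empty_iff Ball_def)
qed

lemma (in graph) proper_colouring_exists: "\<exists>k c. proper_colouring G k c"
proof -
  obtain c :: "'a \<Rightarrow> nat" and n where c: "c ` verts G = {i. i < n}" "inj_on c (verts G)"
    using finite_imp_inj_to_nat_seg[OF finite_verts] by blast
  have "proper_colouring G n c"
    unfolding proper_colouring_def using c adj_not_same by (auto simp: inj_on_eq_iff)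
  then show ?thesis by blast
qed

lemma (in graph) cube_representation_exists: "\<exists>k f. cube_representation G k f"
proof -
  obtain c :: "'a \<Rightarrow> nat" and n where c: "c ` verts G = {i. i < n}" "inj_on c (verts G)"
    using finite_imp_inj_to_nat_seg[OF finite_verts] by blast
  define f :: "'a \<Rightarrow> nat \<Rightarrow> real" where
    "f u i = (if c u = i then 0 else if \<exists>w\<in>verts G. c w = i \<and> w \<rightarrow>\<^bsub>G\<^esub> u then 1 else 3/2)" for u i
  have "u \<rightarrow>\<^bsub>G\<^esub> v \<longleftrightarrow> (\<forall>i<n. \<bar>f u i - f v i\<bar> \<le> 1)"
    if uv: "u \<in> verts G" "v \<in> verts G" "u \<noteq> v" for u v
  proof
    assume "u \<rightarrow>\<^bsub>G\<^esub> v"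
    moreover from this have "v \<rightarrow>\<^bsub>G\<^esub> u"
      using sym_arcs by (rule arcs_ends_symmetric[rotated])
    ultimately show "\<forall>i<n. \<bar>f u i - f v i\<bar> \<le> 1"
      using uv c(2) by (auto simp: f_def)
  next
    assume *: "\<forall>i<n. \<bar>f u i - f v i\<bar> \<le> 1"
    have "c u < n" using c(1) uv(1) by blast
    then have "\<bar>f u (c u) - f v (c u)\<bar> \<le> 1" using * by blast
    moreover have "c v \<noteq> c u" using uv c(2) by (auto simp: inj_on_eq_iff)
    ultimately have "\<exists>w\<in>verts G. c w = c u \<and> w \<rightarrow>\<^bsub>G\<^esub> v"
      by (auto simp: f_def split: if_splits)
    then show "u \<rightarrow>\<^bsub>G\<^esub> v" using uv c(2) by (auto simp: inj_on_eq_iff)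
  qed
  then have "cube_representation G n f"
    unfolding cube_representation_def by (simp add: unit_cube_Int_nonempty_iff)
  then show ?thesis by blast
qed

end

theory Submission
  imports Defs
begin

text \<open>
  Extend each colour class to a maximal independent set \<open>T\<close>. It suffices to find, for every such
  \<open>T\<close>, a unit interval supergraph of \<open>G\<close> that preserves all non-edges incident to \<open>T\<close>. Join two
  elements of \<open>T\<close> when they are connected by a path with one or two inner vertices that see no other
  element of \<open>T\<close>. A cycle, or a vertex of degree three, in this auxiliary graph would yield an
  asteroidal triple of \<open>G\<close>; hence it is a disjoint union of paths, and \<open>T\<close> can be enumerated as
  \<open>s\<^sub>0, s\<^sub>1, \<dots>\<close> so that joined elements are consecutive. By claw-freeness every vertex outside \<open>T\<close>
  is then adjacent either to exactly one \<open>s\<^sub>i\<close> or to exactly \<open>s\<^sub>i\<close> and \<open>s\<^sub>i\<^sub>+\<^sub>1\<close>, and the positions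
  of the unit intervals can be written down explicitly.
\<close>

section \<open>Arranging a relation without asteroidal triples on a line\<close>

lemma successively_nth_rtranclp:
  assumes xs: "successively Q xs" and ij: "i \<le> j" "j < length xs"
    and c: "c \<notin> (!) xs ` {i..j}"
  shows "(\<lambda>x y. Q x y \<and> x \<noteq> c \<and> y \<noteq> c)\<^sup>*\<^sup>* (xs ! i) (xs ! j)"
  using ij c
proof (induction j rule: dec_induct)
  case (step n)
  have "(\<lambda>x y. Q x y \<and> x \<noteq> c \<and> y \<noteq> c)\<^sup>*\<^sup>* (xs ! i) (xs ! n)"
    using step.prems by (intro step.IH) auto
  moreover have "Q (xs ! n) (xs ! Suc n)"
    using xs step.prems by (simp add: successively_conv_nth)
  moreover have "xs ! n \<noteq> c" "xs ! Suc n \<noteq> c"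
    using step by auto
  ultimately show ?case
    by (simp add: rtranclp.rtrancl_into_rtrancl)
qed auto

text \<open>The shadow of an asteroidal triple on the auxiliary relation: avoiding the neighbourhood
  of a vertex becomes avoiding that single element. Independence in the graph comes later from the
  set on which the relation lives.\<close>

definition relation_AT :: "('a \<Rightarrow> 'a \<Rightarrow> bool) \<Rightarrow> 'a \<Rightarrow> 'a \<Rightarrow> 'a \<Rightarrow> bool" where
  "relation_AT Q a b c \<longleftrightarrow> distinct [a, b, c] \<and>
     (\<lambda>x y. Q x y \<and> x \<noteq> c \<and> y \<noteq> c)\<^sup>*\<^sup>* a b \<and>
     (\<lambda>x y. Q x y \<and> x \<noteq> a \<and> y \<noteq> a)\<^sup>*\<^sup>* b c \<and>
     (\<lambda>x y. Q x y \<and> x \<noteq> b \<and> y \<noteq> b)\<^sup>*\<^sup>* a c"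

text \<open>A neighbour off the path either prolongs it at an end or hangs from an inner element,
  which gives a star with three leaves; a chord closes a cycle. Stars and cycles both contain a
  \<open>relation_AT\<close>. Loops of \<open>Q\<close> are permitted, so \<open>i = j\<close> can
  occur.\<close>

lemma longest_path_is_component:
  assumes sym: "\<And>x y. Q x y \<Longrightarrow> Q y x"
    and AT: "\<And>a b c. a \<in> S \<Longrightarrow> b \<in> S \<Longrightarrow> c \<in> S \<Longrightarrow> \<not> relation_AT Q a b c"
    and xs: "distinct xs" "set xs \<subseteq> S" "successively Q xs"
    and longest: "\<And>ys. distinct ys \<Longrightarrow> set ys \<subseteq> S \<Longrightarrow> successively Q ys \<Longrightarrow> length ys \<le> length xs"
    and i: "i < length xs" and u: "u \<in> S" "Q (xs ! i) u"
  obtains j where "j < length xs" "u = xs ! j" "i \<le> Suc j" "j \<le> Suc i"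
proof -
  have Q_Suc: "Q (xs ! k) (xs ! Suc k)" if "Suc k < length xs" for k
    using xs(3) that by (simp add: successively_conv_nth)
  have inS: "xs ! k \<in> S" if "k < length xs" for k
    using xs(2) that by auto
  have neq: "xs ! k = xs ! l \<longleftrightarrow> k = l" if "k < length xs" "l < length xs" for k l
    using xs(1) that by (simp add: nth_eq_iff_index_eq)
  have no_chord: "\<not> Q (xs ! k) (xs ! l)" if kl: "Suc k < l" "l < length xs" for k l
  proof
    assume Q: "Q (xs ! k) (xs ! l)"
    have "xs ! k \<notin> (!) xs ` {Suc k..l}"
      using kl by (auto simp: neq)
    then have "(\<lambda>x y. Q x y \<and> x \<noteq> xs ! k \<and> y \<noteq> xs ! k)\<^sup>*\<^sup>* (xs ! Suc k) (xs ! l)"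
      using kl by (intro successively_nth_rtranclp[OF xs(3)]) auto
    \<comment> \<open>On the closed cycle, the edge at \<open>k\<close>, the rest of the path and
      the chord each join two of the three elements and miss the third.\<close>
    then have "relation_AT Q (xs ! k) (xs ! Suc k) (xs ! l)"
      unfolding relation_AT_def using kl Q Q_Suc[of k]
      by (auto simp: neq intro!: r_into_rtranclp)
    then show False
      using AT inS kl by (meson Suc_lessD less_trans)
  qed
  have "u \<in> set xs"
  proof (rule ccontr)
    assume nin: "u \<notin> set xs"
    have "i \<noteq> 0"
    proof
      assume "i = 0"
      then have "successively Q (u # xs)"
        using u i xs(3) sym by (cases xs) auto
      then show False
        using longest[of "u # xs"] u nin xs by auto
    qed
    then obtain k where k: "i = Suc k"
      by (cases i) auto
    have "Suc i < length xs"
    proof (rule ccontr)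
      assume "\<not> Suc i < length xs"
      then have "i = length xs - 1" "xs \<noteq> []"
        using i by auto
      then have "xs ! i = last xs"
        by (simp add: last_conv_nth)
      then have "successively Q (xs @ [u])"
        using u xs(3) by (auto simp: successively_append_iff)
      then show False
        using longest[of "xs @ [u]"] u nin xs by auto
    qed
    then have len: "Suc (Suc k) < length xs"
      using k by simp
    have un: "u \<noteq> xs ! l" if "l < length xs" for l
      using nin that by auto
    \<comment> \<open>Here \<open>xs ! Suc k\<close> is the centre of a star with leaves
      \<open>xs ! k\<close>, \<open>xs ! Suc (Suc k)\<close> and \<open>u\<close>; any two leaves
      are joined through the centre, which avoids the third.\<close>
    let ?R = "\<lambda>c x y. Q x y \<and> x \<noteq> c \<and> y \<noteq> c"
    have Qs: "Q (xs ! k) (xs ! Suc k)" "Q (xs ! Suc k) (xs ! Suc (Suc k))"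
        "Q (xs ! Suc (Suc k)) (xs ! Suc k)" "Q (xs ! Suc k) u"
      using Q_Suc len sym u k by auto
    have ne: "xs ! k \<noteq> xs ! Suc k" "xs ! k \<noteq> xs ! Suc (Suc k)" "xs ! Suc k \<noteq> xs ! Suc (Suc k)"
        "u \<noteq> xs ! k" "u \<noteq> xs ! Suc k" "u \<noteq> xs ! Suc (Suc k)"
      using len un by (auto simp: neq)
    have "(?R u)\<^sup>*\<^sup>* (xs ! k) (xs ! Suc (Suc k))"
      by (rule converse_rtranclp_into_rtranclp[of _ _ "xs ! Suc k"]) (use Qs ne in auto)
    moreover have "(?R (xs ! k))\<^sup>*\<^sup>* (xs ! Suc (Suc k)) u"
      by (rule converse_rtranclp_into_rtranclp[of _ _ "xs ! Suc k"]) (use Qs ne in auto)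
    moreover have "(?R (xs ! Suc (Suc k)))\<^sup>*\<^sup>* (xs ! k) u"
      by (rule converse_rtranclp_into_rtranclp[of _ _ "xs ! Suc k"]) (use Qs ne in auto)
    ultimately have "relation_AT Q (xs ! k) (xs ! Suc (Suc k)) u"
      unfolding relation_AT_def using ne by auto
    then show False
      using AT[of "xs ! k" "xs ! Suc (Suc k)" u] inS len u by auto
  qed
  then obtain j where j: "j < length xs" "u = xs ! j"
    by (auto simp: in_set_conv_nth)
  moreover have "i \<le> Suc j"
    using no_chord[of j i] i u sym j by force
  moreover have "j \<le> Suc i"
    using no_chord[of i j] u j by force
  ultimately show ?thesis
    using that by blast
qed

text \<open>Split off a longest path, number it in order and place the rest behind it by induction;
  no pair in \<open>Q\<close> crosses between the two blocks. As \<open>Q\<close> is symmetric, the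
  one-sided bound gives distance at most 1.\<close>

lemma linear_arrangement_exists:
  assumes "finite S"
    and sym: "\<And>x y. Q x y \<Longrightarrow> Q y x"
    and AT: "\<And>a b c. a \<in> S \<Longrightarrow> b \<in> S \<Longrightarrow> c \<in> S \<Longrightarrow> \<not> relation_AT Q a b c"
  shows "\<exists>p :: 'a \<Rightarrow> nat. inj_on p S \<and> p ` S \<subseteq> {..<card S} \<and>
           (\<forall>s\<in>S. \<forall>t\<in>S. Q s t \<longrightarrow> p s \<le> Suc (p t))"
  using assms(1,3)
proof (induction S rule: finite_psubset_induct)
  case (psubset S)
  show ?case
  proof (cases "S = {}")
    case False
    then obtain z where z: "z \<in> S"
      by blast
    let ?P = "\<lambda>xs. distinct xs \<and> set xs \<subseteq> S \<and> successively Q xs"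
    have "\<exists>xs. ?P xs \<and> (\<forall>ys. ?P ys \<longrightarrow> length ys \<le> length xs)"
    proof (rule ex_has_greatest_nat[of _ "[]"])
      show "\<forall>ys. ?P ys \<longrightarrow> length ys < Suc (card S)"
        using psubset.hyps by (metis card_mono distinct_card le_imp_less_Suc)
    qed auto
    then obtain xs where xs: "distinct xs" "set xs \<subseteq> S" "successively Q xs"
      and longest: "\<And>ys. ?P ys \<Longrightarrow> length ys \<le> length xs"
      by blast
    have "xs \<noteq> []"
      using longest[of "[z]"] z by auto
    then have "S - set xs \<subset> S"
      using xs(2) by (cases xs) auto
    then obtain q :: "'a \<Rightarrow> nat" where q: "inj_on q (S - set xs)" "q ` (S - set xs) \<subseteq> {..<card (S - set xs)}"
      "\<And>s t. s \<in> S - set xs \<Longrightarrow> t \<in> S - set xs \<Longrightarrow> Q s t \<Longrightarrow> q s \<le> Suc (q t)"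
      using psubset.IH[of "S - set xs"] psubset.prems by (metis DiffD1)
    define idx where "idx = the_inv_into {..<length xs} ((!) xs)"
    have idx: "idx (xs ! i) = i" if "i < length xs" for i
      unfolding idx_def using xs(1) that by (auto intro!: the_inv_into_f_f inj_on_nth)
    define p where "p x = (if x \<in> set xs then idx x else length xs + q x)" for x
    have len: "length xs + card (S - set xs) = card S"
      using xs psubset.hyps
      by (metis card_Diff_subset card_mono distinct_card finite_set le_add_diff_inverse)
    have path: "t \<in> set xs \<and> idx s \<le> Suc (idx t) \<and> idx t \<le> Suc (idx s)"
      if st: "s \<in> set xs" "t \<in> S" "Q s t" for s t
    proof -
      obtain i where i: "i < length xs" "s = xs ! i"
        using st(1) by (auto simp: in_set_conv_nth)
      obtain j where "j < length xs" "t = xs ! j" "i \<le> Suc j" "j \<le> Suc i"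
        using longest_path_is_component[OF sym psubset.prems xs _ i(1), of t] longest st i by blast
      then show ?thesis
        using i idx by auto
    qed
    have "p s \<le> Suc (p t)" if st: "s \<in> S" "t \<in> S" "Q s t" for s t
      using path[of s t] path[of t s] st sym[OF st(3)] q(3)[of s t] by (auto simp: p_def)
    moreover have "inj_on p S"
    proof (rule inj_onI)
      fix x y assume xy: "x \<in> S" "y \<in> S" "p x = p y"
      have "idx x < length xs" if "x \<in> set xs" for x
        using that idx by (auto simp: in_set_conv_nth)
      moreover have "x = y" if "x \<in> set xs" "y \<in> set xs" "idx x = idx y"
        using that idx by (auto simp: in_set_conv_nth)
      ultimately show "x = y"
        using xy q(1) unfolding p_def by (fastforce split: if_splits dest: inj_onD)
    qed
    moreover have "p ` S \<subseteq> {..<card S}"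
      using q(2) idx len unfolding p_def by (fastforce simp: in_set_conv_nth)
    ultimately show ?thesis
      by blast
  qed auto
qed

section \<open>Avoiding paths and claws\<close>

text \<open>A walk built along the chain is shortened to a path on some of its vertices. The
  assumption on \<open>v\<close> covers the empty chain, about which the relation says
  nothing.\<close>

lemma (in wf_digraph) path_avoidingI:
  assumes "(\<lambda>x y. x \<rightarrow>\<^bsub>G\<^esub> y \<and> x \<notin> S \<and> y \<notin> S)\<^sup>*\<^sup>* u v" "v \<in> verts G" "v \<notin> S"
  shows "path_avoiding G u v S"
proof -
  have "\<exists>p. vwalk p G \<and> hd p = u \<and> last p = v \<and> set p \<inter> S = {}"
    using assms
  proof (induction rule: converse_rtranclp_induct)
    case base
    then show ?case
      by (intro exI[of _ "[v]"]) auto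
  next
    case (step x y)
    then obtain p where p: "vwalk p G" "hd p = y" "last p = v" "set p \<inter> S = {}"
      by blast
    then have "vwalk (x # p) G"
      using step.hyps by (intro vwalk_wf_digraph_consI) auto
    then show ?case
      using p step.hyps by (intro exI[of _ "x # p"]) (auto simp: vwalk_def)
  qed
  then obtain p where "vwalk p G" "hd p = u" "last p = v" "set p \<inter> S = {}"
    by blast
  then show ?thesis
    unfolding path_avoiding_def
    by (intro exI[of _ "vwalk_to_vpath p"])
      (auto simp: vwalk_to_vpath_vpath vwalk_to_vpath_hd vwalk_to_vpath_last dest!: vwalk_to_vpath_subset)
qed

lemma (in sym_digraph) adj_sym: "u \<rightarrow>\<^bsub>G\<^esub> v \<Longrightarrow> v \<rightarrow>\<^bsub>G\<^esub> u"
  by (rule arcs_ends_symmetric[OF sym_arcs])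

text \<open>Otherwise \<open>c\<close> and its three neighbours would induce a claw with centre
  \<open>c\<close>.\<close>

lemma (in graph) claw_freeD:
  assumes cf: "claw_free G" and adj: "c \<rightarrow>\<^bsub>G\<^esub> x" "c \<rightarrow>\<^bsub>G\<^esub> y" "c \<rightarrow>\<^bsub>G\<^esub> z" and "distinct [x, y, z]"
  shows "x \<rightarrow>\<^bsub>G\<^esub> y \<or> x \<rightarrow>\<^bsub>G\<^esub> z \<or> y \<rightarrow>\<^bsub>G\<^esub> z"
proof (rule ccontr)
  assume indep: "\<not> ?thesis"
  let ?H = "G \<restriction> {c, x, y, z}"
  have sub: "{c, x, y, z} \<subseteq> verts G"
    using adj adj_in_verts by auto
  have ind: "induced_subgraph ?H G"
    using sub by (rule induced_induce)
  then have "graph ?H"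
    using digraphI_induced induced_graph_imp_graph
    by (simp add: graph_def pseudo_graph_def digraph_def)
  have ne: "c \<noteq> x" "c \<noteq> y" "c \<noteq> z" and irr: "\<not> u \<rightarrow>\<^bsub>G\<^esub> u" for u
    using adj adj_not_same by blast+
  have "arcs_ends ?H = {(u, v). u \<rightarrow>\<^bsub>G\<^esub> v \<and> u \<in> {c, x, y, z} \<and> v \<in> {c, x, y, z}}"
    by (auto simp: arcs_ends_def arc_to_ends_def)
  also have "\<dots> = {c} \<times> {x, y, z} \<union> {x, y, z} \<times> {c}"
    using indep adj adj_sym irr by auto
  finally have ends: "arcs_ends ?H = {c} \<times> {x, y, z} \<union> {x, y, z} \<times> {c}" .
  have "verts ?H = {c} \<union> {x, y, z}" "{c} \<inter> {x, y, z} = {}" "card {c} = 1" "card {x, y, z} = 3"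
    using ne assms(5) by auto
  with ends \<open>graph ?H\<close> have "K\<^bsub>1,3\<^esub> ?H"
    unfolding complete_bipartite_digraph_def by metis
  with ind have "\<exists>H. induced_subgraph H G \<and> K\<^bsub>1,3\<^esub> H"
    by (intro exI[of _ ?H] conjI)
  with cf show False
    unfolding claw_free_def by (rule notE)
qed

section \<open>Links between elements of an independent set\<close>

definition linked :: "('a, 'b) pre_digraph \<Rightarrow> 'a set \<Rightarrow> 'a \<Rightarrow> 'a \<Rightarrow> bool" where
  "linked G T s t \<longleftrightarrow> s \<in> T \<and> t \<in> T \<and>
     (\<exists>a b. s \<rightarrow>\<^bsub>G\<^esub> a \<and> (a = b \<or> a \<rightarrow>\<^bsub>G\<^esub> b) \<and> b \<rightarrow>\<^bsub>G\<^esub> t \<and>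
        (\<forall>u\<in>T. u \<rightarrow>\<^bsub>G\<^esub> a \<or> u \<rightarrow>\<^bsub>G\<^esub> b \<longrightarrow> u = s \<or> u = t))"

lemma (in graph) linked_sym: "linked G T s t \<Longrightarrow> linked G T t s"
  unfolding linked_def by (metis adj_sym)

text \<open>Every link whose ends differ from \<open>c\<close> expands to a path that misses the
  neighbourhood of \<open>c\<close>: its inner vertices see no element of \<open>T\<close> but the
  ends, and the ends are not adjacent to \<open>c\<close> by independence.\<close>

lemma (in graph) linked_rtranclp_path_avoiding:
  assumes T: "independent_set G T" and "a \<in> T" "b \<in> T" "c \<in> T"
    and link: "(\<lambda>x y. linked G T x y \<and> x \<noteq> c \<and> y \<noteq> c)\<^sup>*\<^sup>* a b"
  shows "path_avoiding G a b (neighbourhood G c)"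
proof (rule path_avoidingI)
  let ?R = "\<lambda>x y. x \<rightarrow>\<^bsub>G\<^esub> y \<and> x \<notin> neighbourhood G c \<and> y \<notin> neighbourhood G c"
  have "?R\<^sup>*\<^sup>* s t" if st: "linked G T s t" "s \<noteq> c" "t \<noteq> c" for s t
  proof -
    obtain x y where xy: "s \<rightarrow>\<^bsub>G\<^esub> x" "x = y \<or> x \<rightarrow>\<^bsub>G\<^esub> y" "y \<rightarrow>\<^bsub>G\<^esub> t"
      and only: "\<And>u. u \<in> T \<Longrightarrow> u \<rightarrow>\<^bsub>G\<^esub> x \<or> u \<rightarrow>\<^bsub>G\<^esub> y \<Longrightarrow> u = s \<or> u = t"
      and inT: "s \<in> T" "t \<in> T"
      using st(1) unfolding linked_def by blast
    have "s \<notin> neighbourhood G c" "x \<notin> neighbourhood G c" "y \<notin> neighbourhood G c" "t \<notin> neighbourhood G c"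
      using only[OF \<open>c \<in> T\<close>] st inT \<open>c \<in> T\<close> T
      unfolding neighbourhood_def independent_set_def by auto
    then have R: "?R\<^sup>*\<^sup>* s x" "?R\<^sup>*\<^sup>* x y" "?R\<^sup>*\<^sup>* y t"
      using xy by auto
    show ?thesis
      by (rule rtranclp_trans[OF rtranclp_trans[OF R(1,2)] R(3)])
  qed
  with link show "?R\<^sup>*\<^sup>* a b"
    by (induction rule: rtranclp_induct) (auto intro: rtranclp_trans)
qed (use assms in \<open>auto simp: independent_set_def neighbourhood_def\<close>)

text \<open>A third element of \<open>T\<close> adjacent to \<open>v\<close> would complete a claw
  centred at \<open>v\<close>, so \<open>v\<close> serves as the single inner vertex.\<close>

lemma (in graph) common_neighbour_linked:
  assumes cf: "claw_free G" and T: "independent_set G T"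
    and st: "s \<in> T" "t \<in> T" "s \<noteq> t" "s \<rightarrow>\<^bsub>G\<^esub> v" "t \<rightarrow>\<^bsub>G\<^esub> v"
  shows "linked G T s t"
proof -
  have indep: "\<not> x \<rightarrow>\<^bsub>G\<^esub> y" if "x \<in> T" "y \<in> T" for x y
    using T that unfolding independent_set_def by blast
  have "u = s \<or> u = t" if u: "u \<in> T" "u \<rightarrow>\<^bsub>G\<^esub> v" for u
  proof (rule ccontr)
    assume "\<not> (u = s \<or> u = t)"
    then have "distinct [s, t, u]"
      using st by auto
    then show False
      using claw_freeD[OF cf adj_sym[OF st(4)] adj_sym[OF st(5)] adj_sym[OF u(2)]] indep st u by blast
  qed
  then show ?thesis
    unfolding linked_def using st adj_sym by blast
qed

text \<open>A \<open>relation_AT\<close> of links expands to an asteroidal triple of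
  \<open>G\<close>. AT-freeness enters the proof only here.\<close>

lemma (in graph) independent_set_arrangement:
  assumes AT: "AT_free G" and T: "independent_set G T"
  shows "\<exists>p :: 'a \<Rightarrow> nat. inj_on p T \<and> p ` T \<subseteq> {..<card T} \<and>
           (\<forall>s\<in>T. \<forall>t\<in>T. linked G T s t \<longrightarrow> p s \<le> Suc (p t))"
proof (rule linear_arrangement_exists)
  show "finite T"
    using T finite_verts unfolding independent_set_def by (meson finite_subset)
  show "linked G T x y \<Longrightarrow> linked G T y x" for x y
    by (rule linked_sym)
  fix a b c
  assume abc: "a \<in> T" "b \<in> T" "c \<in> T"
  show "\<not> relation_AT (linked G T) a b c"
  proof
    assume "relation_AT (linked G T) a b c"
    then have "asteroidal_triple G a b c"
      unfolding relation_AT_def asteroidal_triple_def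
      using abc T linked_rtranclp_path_avoiding[OF T]
      by (auto simp: independent_set_def)
    then show False
      using AT unfolding AT_free_def by blast
  qed
qed

section \<open>Unit intervals for one maximal independent set\<close>

lemma (in graph) unit_interval_supergraph:
  assumes AT: "AT_free G" and cf: "claw_free G" and T: "independent_set G T"
    and dominating: "\<forall>v\<in>verts G - T. \<exists>s\<in>T. s \<rightarrow>\<^bsub>G\<^esub> v"
  shows "\<exists>f :: 'a \<Rightarrow> real. (\<forall>u v. u \<rightarrow>\<^bsub>G\<^esub> v \<longrightarrow> \<bar>f u - f v\<bar> \<le> 1) \<and>
           (\<forall>s\<in>T. \<forall>v\<in>verts G. s \<noteq> v \<longrightarrow> \<not> s \<rightarrow>\<^bsub>G\<^esub> v \<longrightarrow> \<bar>f s - f v\<bar> > 1)"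
proof -
  obtain p :: "'a \<Rightarrow> nat" where p: "inj_on p T" "p ` T \<subseteq> {..<card T}"
    and linked: "\<forall>s\<in>T. \<forall>t\<in>T. linked G T s t \<longrightarrow> p s \<le> Suc (p t)"
    using independent_set_arrangement[OF AT T] by (elim exE conjE)
  have common: "p s \<le> Suc (p t)" if "s \<in> T" "t \<in> T" "s \<rightarrow>\<^bsub>G\<^esub> v" "t \<rightarrow>\<^bsub>G\<^esub> v" for s t v
    using common_neighbour_linked[OF cf T, of s t v] linked that by (cases "s = t") auto
  have fin: "finite T"
    using T finite_verts unfolding independent_set_def by (meson finite_subset)
  have indep: "\<not> s \<rightarrow>\<^bsub>G\<^esub> t" if "s \<in> T" "t \<in> T" for s t
    using T that unfolding independent_set_def by blast
  have p_inj: "p s = p t \<longleftrightarrow> s = t" if "s \<in> T" "t \<in> T" for s t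
    using p(1) that by (simp add: inj_on_eq_iff)
  \<comment> \<open>Vertices are sorted by the elements of \<open>T\<close> that they equal or see.
    In class A (\<open>lo v = hi v\<close>) there is one such element; in class B
    (\<open>lo v < hi v\<close>) there are two, in consecutive positions. The suffixes A and B below
    refer to these classes.\<close>
  define N where "N v = {s \<in> T. s = v \<or> s \<rightarrow>\<^bsub>G\<^esub> v}" for v
  define lo where "lo v = Min (p ` N v)" for v
  define hi where "hi v = Max (p ` N v)" for v
  have N: "N v \<subseteq> T" "finite (N v)" for v
    using fin by (auto simp: N_def)
  have N_ne: "N v \<noteq> {}" if "v \<in> verts G" for v
    using dominating that by (cases "v \<in> T") (auto simp: N_def)
  have lo_hi_p: "lo v \<le> p s" "p s \<le> hi v" if "s \<in> N v" for s v
    using that N by (auto simp: lo_def hi_def)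
  have lo_ex: "\<exists>s\<in>N v. p s = lo v" and hi_ex: "\<exists>s\<in>N v. p s = hi v" if "v \<in> verts G" for v
  proof -
    have "lo v \<in> p ` N v" "hi v \<in> p ` N v"
      unfolding lo_def hi_def using N N_ne[OF that] by auto
    then show "\<exists>s\<in>N v. p s = lo v" "\<exists>s\<in>N v. p s = hi v"
      by force+
  qed
  have N_T: "N v = {v}" if "v \<in> T" for v
    using that indep by (auto simp: N_def)
  have lo_T: "lo v = p v" "hi v = p v" if "v \<in> T" for v
    using N_T[OF that] by (auto simp: lo_def hi_def)
  have hi_cases: "hi v = lo v \<or> hi v = Suc (lo v)" if v: "v \<in> verts G" for v
  proof (cases "v \<in> T")
    case False
    obtain s t where "s \<in> N v" "p s = lo v" "t \<in> N v" "p t = hi v"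
      using lo_ex[OF v] hi_ex[OF v] by blast
    then show ?thesis
      using common[of t s v] False lo_hi_p[of t v] by (force simp: N_def)
  qed (simp add: lo_T)
  have N_iff: "s \<in> N v \<longleftrightarrow> p s = lo v \<or> p s = hi v" if "v \<in> verts G" "s \<in> T" for s v
    using lo_ex[OF that(1)] hi_ex[OF that(1)] hi_cases[OF that(1)] lo_hi_p[of s v] p_inj[OF that(2)] N(1)[of v]
    by (metis le_SucE le_antisym subset_eq)
  have hi_less: "hi v < card T" if "v \<in> verts G" for v
    using hi_ex[OF that] p(2) N(1)[of v] by force
  \<comment> \<open>A class B vertex \<open>u\<close> sees two nonadjacent elements of
    \<open>T\<close>. If \<open>v\<close> is neither of them, claw-freeness at \<open>u\<close>
    makes \<open>v\<close> adjacent to one of them.\<close>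
  have meet: "\<exists>s. s \<in> N u \<and> s \<in> N v" if uv: "u \<rightarrow>\<^bsub>G\<^esub> v" "lo u < hi u" for u v
  proof -
    have V: "u \<in> verts G" "v \<in> verts G"
      using uv adj_in_verts by auto
    obtain s t where st: "s \<in> N u" "p s = lo u" "t \<in> N u" "p t = hi u"
      using lo_ex[OF V(1)] hi_ex[OF V(1)] by blast
    have "u \<notin> T"
      using lo_T uv(2) by force
    then have st': "s \<in> T" "t \<in> T" "s \<rightarrow>\<^bsub>G\<^esub> u" "t \<rightarrow>\<^bsub>G\<^esub> u" "s \<noteq> t"
      using st uv(2) by (auto simp: N_def)
    show ?thesis
    proof (cases "v = s \<or> v = t")
      case False
      then have "s \<rightarrow>\<^bsub>G\<^esub> v \<or> t \<rightarrow>\<^bsub>G\<^esub> v"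
        using claw_freeD[OF cf, of u s t v] st' uv(1) adj_sym indep by auto
      then show ?thesis
        using st st' by (auto simp: N_def)
    qed (use st st' N_T in auto)
  qed
  \<comment> \<open>If both ends lie outside \<open>T\<close>, then \<open>t\<close>,
    \<open>v\<close>, \<open>u\<close>, \<open>s\<close> is a link with two inner vertices, as each
    of \<open>u\<close> and \<open>v\<close> sees only one element of \<open>T\<close>.\<close>
  have near: "lo v \<le> Suc (lo u)" if uv: "u \<rightarrow>\<^bsub>G\<^esub> v" "lo u = hi u" "lo v = hi v" for u v
  proof -
    have V: "u \<in> verts G" "v \<in> verts G"
      using uv adj_in_verts by auto
    obtain s t where st: "s \<in> N u" "p s = lo u" "t \<in> N v" "p t = lo v"
      using lo_ex[OF V(1)] lo_ex[OF V(2)] by blast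
    then have only: "x \<in> N u \<Longrightarrow> x = s" "x \<in> N v \<Longrightarrow> x = t" for x
      using N_iff[OF V(1)] N_iff[OF V(2)] uv p_inj N(1) by (metis subset_eq)+
    consider "u \<in> T" | "v \<in> T" | "u \<notin> T" "v \<notin> T" by blast
    then show ?thesis
    proof cases
      case 1
      then have "u \<in> N v" using uv by (simp add: N_def)
      then show ?thesis using lo_hi_p[of u v] lo_T 1 uv by simp
    next
      case 2
      then have "v \<in> N u" using uv adj_sym by (simp add: N_def)
      then show ?thesis using lo_hi_p[of v u] lo_T 2 uv by simp
    next
      case 3
      then have adj: "s \<in> T" "t \<in> T" "t \<rightarrow>\<^bsub>G\<^esub> v" "u \<rightarrow>\<^bsub>G\<^esub> s" "v \<rightarrow>\<^bsub>G\<^esub> u"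
        using st uv adj_sym by (auto simp: N_def)
      have "x = t \<or> x = s" if "x \<in> T" "x \<rightarrow>\<^bsub>G\<^esub> v \<or> x \<rightarrow>\<^bsub>G\<^esub> u" for x
        using only[of x] that by (auto simp: N_def)
      then have "linked G T t s"
        unfolding linked_def using adj by blast
      then have "p t \<le> Suc (p s)"
        using linked adj(1,2) by blast
      then show ?thesis using st by simp
    qed
  qed
  \<comment> \<open>Marks the class A vertices that must move right in order to reach a class A
    neighbour one position further on.\<close>
  define up where "up v \<longleftrightarrow> lo v = hi v \<and> (\<exists>w. v \<rightarrow>\<^bsub>G\<^esub> w \<and> lo w = hi w \<and> lo w = Suc (lo v))" for v
  have up_T: "\<not> up v" if "v \<in> T" for v
  proof
    assume "up v"
    then obtain w where w: "v \<rightarrow>\<^bsub>G\<^esub> w" "lo w = Suc (lo v)"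
      unfolding up_def by blast
    then have "v \<in> N w"
      using that by (simp add: N_def)
    then show False
      using lo_hi_p[of v w] lo_T that w by simp
  qed
  \<comment> \<open>The upper end of such an edge needs no move to the right itself: a class A
    neighbour \<open>u\<close> below, one \<open>w\<close> above and the element \<open>s\<close> of
    \<open>T\<close> seen by \<open>v\<close> would form a claw at \<open>v\<close>.\<close>
  have not_up: "\<not> up v" if uv: "u \<rightarrow>\<^bsub>G\<^esub> v" "lo u = hi u" "lo v = hi v" "lo v = Suc (lo u)" for u v
  proof
    assume "up v"
    then obtain w where w: "v \<rightarrow>\<^bsub>G\<^esub> w" "lo w = hi w" "lo w = Suc (lo v)"
      unfolding up_def by blast
    have V: "u \<in> verts G" "v \<in> verts G" "w \<in> verts G"
      using uv w adj_in_verts by auto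
    obtain s where s: "s \<in> N v" "p s = lo v"
      using lo_ex[OF V(2)] by blast
    have "v \<notin> T"
      using up_T \<open>up v\<close> by blast
    then have sv: "s \<in> T" "s \<rightarrow>\<^bsub>G\<^esub> v"
      using s by (auto simp: N_def)
    have "s \<notin> N u" "s \<notin> N w"
      using N_iff[OF V(1) sv(1)] N_iff[OF V(3) sv(1)] s uv w by auto
    then have "s \<noteq> u" "s \<noteq> w" "\<not> s \<rightarrow>\<^bsub>G\<^esub> u" "\<not> s \<rightarrow>\<^bsub>G\<^esub> w"
      using sv by (auto simp: N_def)
    moreover have "\<not> u \<rightarrow>\<^bsub>G\<^esub> w" "u \<noteq> w"
      using near[of u w] uv w by auto
    ultimately show False
      using claw_freeD[OF cf, of v s u w] sv uv w adj_sym by auto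
  qed
  txt \<open>
    The spacing of \<open>T\<close> is \<open>1 + e\<close>, so vertices adjacent to \<open>s\<^sub>i\<close> only have to stay strictly within \<open>e\<close>
    of \<open>s\<^sub>i\<close>. Vertices adjacent to \<open>s\<^sub>i\<close> and \<open>s\<^sub>i\<^sub>+\<^sub>1\<close> drift to the left relative to \<open>s\<^sub>i\<close> as \<open>i\<close> grows,
    which puts consecutive classes of them at distance exactly 1.
  \<close>
  define e :: real where "e = 1 / (card T + 2)"
  have e: "0 < e" "e * (card T + 2) = 1"
    by (auto simp: e_def)
  define f :: "'a \<Rightarrow> real" where
    "f v = (if lo v < hi v then lo v + 1 - e / 2
            else (1 + e) * lo v + (if v \<in> T then 0 else if up v then e / 2 else - e / 2))" for v
  define E where "E v = e * real (lo v)" for v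
  have f_B: "f v = real (lo v) + 1 - e / 2" if "lo v < hi v" for v
    using that by (simp add: f_def)
  have f_A: "\<bar>f v - (lo v + E v)\<bar> \<le> e / 2" if "\<not> lo v < hi v" for v
    using that e(1) by (simp add: f_def E_def algebra_simps)
  \<comment> \<open>The denominator \<open>card T + 2\<close> keeps the accumulated drift
    \<open>E v\<close> at most \<open>1 - 2 * e\<close>. So class B vertices stay within 1 of class
    A neighbours one position further on and more than 1 away from earlier elements of
    \<open>T\<close>.\<close>
  have E_le: "E v + 2 * e \<le> 1" if "v \<in> verts G" for v
  proof -
    have "real (lo v) \<le> card T"
      using hi_less[OF that] hi_cases[OF that] by auto
    then have "e * (lo v + 2) \<le> e * (card T + 2)"
      using e(1) by (intro mult_left_mono) auto
    then show ?thesis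
      using e(2) by (simp add: E_def algebra_simps)
  qed
  have edge: "\<bar>f u - f v\<bar> \<le> 1" if uv: "u \<rightarrow>\<^bsub>G\<^esub> v" and le: "lo u \<le> lo v" for u v
  proof -
    have V: "u \<in> verts G" "v \<in> verts G"
      using uv adj_in_verts by auto
    note hi = hi_cases[OF V(1)] hi_cases[OF V(2)]
    note bounds = e(1) E_le[OF V(1)] E_le[OF V(2)]
    have pos: "0 \<le> E u" "0 \<le> E v"
      using e(1) by (auto simp: E_def)
    have step: "lo v = lo u \<or> lo v = Suc (lo u)"
    proof (cases "lo u < hi u \<or> lo v < hi v")
      case True
      then obtain s where "s \<in> N u" "s \<in> N v"
        using meet[OF uv] meet[OF adj_sym[OF uv]] by blast
      then show ?thesis
        using lo_hi_p[of s u] lo_hi_p[of s v] hi le by linarith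
    next
      case False
      then show ?thesis
        using near[OF uv] hi le by auto
    qed
    \<comment> \<open>The common element given by \<open>meet\<close> has position at least
      \<open>lo v\<close>, beyond \<open>lo u\<close>. Hence an edge that leaves a class A vertex
      upwards ends in class A.\<close>
    have B_step: "lo u < hi u" if B: "lo v = Suc (lo u)" "lo v < hi v"
    proof -
      obtain s where "s \<in> N u" "s \<in> N v"
        using meet[OF adj_sym[OF uv]] B by blast
      then show ?thesis
        using lo_hi_p[of s u] lo_hi_p[of s v] B by linarith
    qed
    from step show ?thesis
    proof
      assume eq: "lo v = lo u"
      show ?thesis
        using f_A[of u] f_A[of v] f_B[of u] f_B[of v] bounds pos eq E_def[of u] E_def[of v]
        by (smt (verit) field_sum_of_halves)
    next
      assume eq: "lo v = Suc (lo u)"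
      then have ev: "E v = E u + e" "real (lo v) = real (lo u) + 1"
        by (auto simp: E_def algebra_simps)
      show ?thesis
      proof (cases "lo u < hi u")
        case True
        then show ?thesis
          using f_B[OF True] f_A[of v] f_B[of v] bounds pos ev
          by (smt (verit) field_sum_of_halves)
      next
        case False
        then have *: "lo u = hi u" "lo v = hi v"
          using hi B_step[OF eq] by auto
        \<comment> \<open>The unshifted positions are \<open>1 + e\<close> apart; \<open>u\<close>
          moves right and \<open>v\<close> moves left by \<open>e / 2\<close>, which leaves exactly
          1.\<close>
        then have "up u" "\<not> up v"
          using uv eq not_up[OF uv] unfolding up_def by auto
        moreover have "u \<notin> T" using up_T \<open>up u\<close> by blast
        moreover have "v \<notin> T"
        proof
          assume "v \<in> T"
          then have "v \<in> N u" using adj_sym[OF uv] by (simp add: N_def)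
          then show False
            using lo_hi_p[of v u] lo_T[OF \<open>v \<in> T\<close>] * eq by simp
        qed
        ultimately show ?thesis
          using * ev by (simp add: f_def E_def algebra_simps)
      qed
    qed
  qed
  show ?thesis
  proof (intro exI[of _ f] conjI allI ballI impI)
    fix u v
    assume uv: "u \<rightarrow>\<^bsub>G\<^esub> v"
    show "\<bar>f u - f v\<bar> \<le> 1"
      using edge[OF uv] edge[OF adj_sym[OF uv]] by (cases "lo u \<le> lo v") (auto simp: abs_minus_commute)
  next
    fix s v
    assume s: "s \<in> T" "v \<in> verts G" "s \<noteq> v" "\<not> s \<rightarrow>\<^bsub>G\<^esub> v"
    then have "s \<notin> N v"
      by (simp add: N_def)
    then have ps: "p s \<noteq> lo v" "p s \<noteq> hi v"
      using N_iff[OF s(2,1)] by auto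
    have fs: "f s = p s + e * p s"
      using lo_T[OF s(1)] s(1) by (simp add: f_def algebra_simps)
    note bounds = e(1) E_le[OF s(2)]
    have pos: "0 \<le> e * p s" "0 \<le> E v"
      using e(1) by (auto simp: E_def)
    have mono: "e * m + e * k \<le> e * n" if "m + k \<le> n" for m n k :: nat
      using e(1) that by (simp flip: distrib_left of_nat_add)
    \<comment> \<open>For a class B vertex, position \<open>lo v + 1\<close> is \<open>hi v\<close>
      and hence excluded, so an element of \<open>T\<close> to the right is at least two positions
      away from \<open>lo v\<close>.\<close>
    consider (left) "p s + 1 \<le> lo v" | (right_A) "lo v + 1 \<le> p s" "hi v = lo v"
      | (right_B) "lo v + 2 \<le> p s" "hi v = Suc (lo v)"
      using ps hi_cases[OF s(2)] by linarith
    then show "\<bar>f s - f v\<bar> > 1"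
    proof cases
      case left
      then have "real (p s) + 1 \<le> lo v" "e * p s + e \<le> E v"
        using mono[OF left] by (auto simp: E_def)
      then show ?thesis
        using fs bounds pos f_A[of v] f_B[of v] by (cases "lo v < hi v") linarith+
    next
      case right_A
      then have "real (lo v) + 1 \<le> p s" "E v + e \<le> e * p s"
        using mono[OF right_A(1)] by (auto simp: E_def)
      then show ?thesis
        using fs bounds pos f_A[of v] right_A(2) by linarith
    next
      case right_B
      then have "real (lo v) + 2 \<le> p s"
        by simp
      then show ?thesis
        using fs bounds pos f_B[of v] right_B(2) by linarith
    qed
  qed
qed

section \<open>From colour classes to cubes\<close>

text \<open>There are finitely many independent sets, and a vertex without a neighbour in a maximal
  one could be added to it.\<close>

lemma (in graph) maximal_independent_set_exists:
  assumes "independent_set G S"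
  shows "\<exists>T. S \<subseteq> T \<and> independent_set G T \<and> (\<forall>v\<in>verts G - T. \<exists>s\<in>T. s \<rightarrow>\<^bsub>G\<^esub> v)"
proof -
  have "finite {T. independent_set G T}"
    using finite_verts by (rule finite_subset[rotated, OF finite_Pow_iff[THEN iffD2]])
      (auto simp: independent_set_def)
  then obtain T where T: "S \<subseteq> T" "independent_set G T"
    and max: "\<And>U. independent_set G U \<Longrightarrow> T \<subseteq> U \<Longrightarrow> T = U"
    using finite_has_maximal2[of "{T. independent_set G T}" S] assms by auto
  have "\<exists>s\<in>T. s \<rightarrow>\<^bsub>G\<^esub> v" if v: "v \<in> verts G" "v \<notin> T" for v
  proof (rule ccontr)
    assume "\<not> (\<exists>s\<in>T. s \<rightarrow>\<^bsub>G\<^esub> v)"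
    then have "independent_set G (insert v T)"
      using T(2) v adj_sym adj_not_same unfolding independent_set_def by blast
    then show False
      using max v by blast
  qed
  then show ?thesis
    using T by blast
qed

lemma (in graph) cube_representation_of_colouring:
  assumes AT: "AT_free G" and cf: "claw_free G" and c: "proper_colouring G k c"
  shows "\<exists>f. cube_representation G k f"
proof -
  have "\<exists>g :: 'a \<Rightarrow> real. (\<forall>u v. u \<rightarrow>\<^bsub>G\<^esub> v \<longrightarrow> \<bar>g u - g v\<bar> \<le> 1) \<and>
      (\<forall>s\<in>verts G. \<forall>v\<in>verts G. c s = i \<longrightarrow> s \<noteq> v \<longrightarrow> \<not> s \<rightarrow>\<^bsub>G\<^esub> v \<longrightarrow> \<bar>g s - g v\<bar> > 1)" for i
  proof -
    have "independent_set G {s \<in> verts G. c s = i}"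
      using c unfolding independent_set_def proper_colouring_def by fastforce
    then obtain T where T: "{s \<in> verts G. c s = i} \<subseteq> T" "independent_set G T"
      "\<forall>v\<in>verts G - T. \<exists>s\<in>T. s \<rightarrow>\<^bsub>G\<^esub> v"
      using maximal_independent_set_exists by meson
    show ?thesis
      using unit_interval_supergraph[OF AT cf T(2,3)] T(1) by (elim ex_forward) auto
  qed
  then obtain g :: "nat \<Rightarrow> 'a \<Rightarrow> real" where
    edge: "\<And>i u v. u \<rightarrow>\<^bsub>G\<^esub> v \<Longrightarrow> \<bar>g i u - g i v\<bar> \<le> 1" and
    nonedge: "\<And>s v. s \<in> verts G \<Longrightarrow> v \<in> verts G \<Longrightarrow> s \<noteq> v \<Longrightarrow> \<not> s \<rightarrow>\<^bsub>G\<^esub> v \<Longrightarrow> \<bar>g (c s) s - g (c s) v\<bar> > 1"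
    by metis
  have "u \<rightarrow>\<^bsub>G\<^esub> v \<longleftrightarrow> (\<forall>i<k. \<bar>g i u - g i v\<bar> \<le> 1)" if "u \<in> verts G" "v \<in> verts G" "u \<noteq> v" for u v
  proof -
    \<comment> \<open>A nonadjacent pair is separated in the coordinate given by the colour of
      \<open>u\<close>, which is one of the first \<open>k\<close>.\<close>
    have "c u < k"
      using c that unfolding proper_colouring_def by auto
    then show ?thesis
      using edge nonedge[OF that] by (meson not_less)
  qed
  then have "cube_representation G k (\<lambda>u i. g i u)"
    unfolding cube_representation_def by (simp add: unit_cube_Int_nonempty_iff)
  then show ?thesis
    by blast
qed

theorem theorem6:
  fixes G :: "('a, 'b) pre_digraph"
  assumes "graph G" and "claw_free G" and "AT_free G"
  shows "cubicity G \<le> chromatic_number G"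
proof -
  interpret graph G by (rule assms(1))
  have "\<exists>c. proper_colouring G (chromatic_number G) c"
    unfolding chromatic_number_def using proper_colouring_exists by (rule LeastI_ex)
  then have "\<exists>f. cube_representation G (chromatic_number G) f"
    using cube_representation_of_colouring[OF assms(3,2)] by blast
  then show ?thesis
    unfolding cubicity_def by (rule Least_le)
qed

end
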